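(* Let $n\ge 2$, $\nu\in(0,1]$, $\beta_1,\dots,\beta_n>0$ and $\bar\beta=\sum_{i=1}^n\beta_i$. Let $(Q_1,\dots,Q_{n-1})$ be a random vector having the fractional Dirichlet probability density function \begin{align*} f_{\bm{Q}}(q_1,\dots,q_{n-1}) = {}& \left( \prod_{i=1}^{n-1} q_i^{\nu \beta_i-1} \right)\left( 1-\sum_{i=1}^{n-1} q_i\right)^{\nu \beta_n-1} \\ &\times \int_0^\infty y^{\nu \bar{\beta} -1} \left(\prod_{i=1}^{n-1} E_{\nu,\nu \beta_i}^{\beta_i}\bigl(-(yq_i)^\nu\bigr)\right) E_{\nu,\nu \beta_n}^{\beta_n} \biggl( -\Bigl( y-y\sum_{i=1}^{n-1}q_i \Bigr)^\nu \biggr)\, \mathrm dy \end{align*} on $\{q_i>0,\ \sum_{i=1}^{n-1}q_i<1\}$. Then, for each $i\in\{1,\dots,n-1\}$, the marginal probability density function of $Q_i$ is, for $q_i\in(0,1)$, \begin{align*} f_{Q_i}(q_i) = {}& q_i^{\nu\beta_i-1}(1-q_i)^{\nu(\bar\beta-\beta_i)-1}\\ &\times\int_0^\infty y^{\nu\bar\beta-1}\,E^{\beta_i}_{\nu,\nu\beta_i}\bigl(-(yq_i)^\nu\bigr)\,E^{\bar\beta-\beta_i}_{\nu,\nu(\bar\beta-\beta_i)}\bigl(-(y(1-q_i))^\nu\bigr)\,\mathrm dy . \end{align*}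
   Context: The three-parameter Mittag-Leffler function is $E_{\alpha,\beta}^\delta(z) = \sum_{r=0}^\infty \frac{z^r}{\Gamma(\alpha r + \beta)}\frac{\Gamma(\delta+r)}{r!\,\Gamma(\delta)}$. For $\lambda>0$, $\beta>0$, $\nu\in(0,1]$, a positive random variable $X$ is fractional Gamma distributed, written $X\sim FG(\lambda,\beta,\nu)$, if it has probability density function $\lambda^\beta x^{\nu\beta-1}E_{\nu,\nu\beta}^{\beta}(-\lambda x^\nu)$, $x>0$; its Laplace transform is $\mathbb{E}e^{-zX}=\left(\frac{\lambda}{\lambda+z^\nu}\right)^\beta$, $z>0$. The density $f_{\bm Q}$ in the claim is that of $(Z_1/W,\dots,Z_{n-1}/W)$, where $Z_1,\dots,Z_n$ are independent, $Z_i\sim FG(1,\beta_i,\nu)$, and $W=Z_1+\dots+Z_n$. *)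

theory Defs
  imports "HOL-Probability.Probability"
begin

definition mittag_leffler3 :: "real \<Rightarrow> real \<Rightarrow> real \<Rightarrow> real \<Rightarrow> real" where
  "mittag_leffler3 \<alpha> \<beta> \<delta> z =
     (\<Sum>r. z ^ r / Gamma (\<alpha> * real r + \<beta>) * (Gamma (\<delta> + real r) / (fact r * Gamma \<delta>)))"

text \<open>
  A point of \<open>\<real>\<^sup>n\<^sup>-\<^sup>1\<close> is a function on the index set \<open>{1..<n}\<close>; the density is taken with respect to
  the product Lebesgue measure on that index set and vanishes off the open simplex.
\<close>

definition frac_dirichlet_density ::
  "nat \<Rightarrow> real \<Rightarrow> (nat \<Rightarrow> real) \<Rightarrow> (nat \<Rightarrow> real) \<Rightarrow> real" where
  "frac_dirichlet_density n \<nu> \<beta> q =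
     (if (\<forall>i\<in>{1..<n}. 0 < q i) \<and> (\<Sum>i\<in>{1..<n}. q i) < 1
      then (\<Prod>i\<in>{1..<n}. q i powr (\<nu> * \<beta> i - 1))
           * (1 - (\<Sum>i\<in>{1..<n}. q i)) powr (\<nu> * \<beta> n - 1)
           * (LBINT y:{0<..}. y powr (\<nu> * (\<Sum>j\<in>{1..n}. \<beta> j) - 1)
                * (\<Prod>i\<in>{1..<n}. mittag_leffler3 \<nu> (\<nu> * \<beta> i) (\<beta> i) (- ((y * q i) powr \<nu>)))
                * mittag_leffler3 \<nu> (\<nu> * \<beta> n) (\<beta> n)
                    (- ((y - y * (\<Sum>i\<in>{1..<n}. q i)) powr \<nu>)))
      else 0)"

end

theory Submission
  imports Defs
begin

text \<open>
  Let \<open>g\<^sub>\<delta>(x) = x powr (\<nu>\<delta> - 1) * E(-x powr \<nu>)\<close> be the fractional Gamma density with shape \<open>\<delta>\<close> and rate 1.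
  After absorbing the powers of \<open>y\<close>, the Dirichlet density is the integral over \<open>y > 0\<close> of
  \<open>y\<^bsup>n-1\<^esup> \<Prod>\<^sub>j g\<^bsub>\<beta> j\<^esub>(y q\<^sub>j)\<close> with \<open>q\<^sub>n = 1 - \<Sum>\<^sub>j q\<^sub>j\<close>, so integrating out all coordinates but one
  amounts to the semigroup law \<open>g\<^sub>\<delta> * g\<^sub>\<epsilon> = g\<^bsub>\<delta> + \<epsilon>\<^esub>\<close> for convolution, a consequence of the Beta integral
  and of Vandermonde's identity applied to the power series.

  Exchanging the integrals requires \<open>g\<^sub>\<delta>\<close> to be nonnegative and integrable. The function
  \<open>e(x) = E\<^bsub>\<nu>,1\<^esub>(-x powr \<nu>)\<close> satisfies \<open>x e = (1 - \<nu>) (e * 1) + \<nu> (e * e)\<close>, and \<open>g\<^sub>\<delta>\<close> satisfies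
  \<open>x g\<^sub>\<delta> = \<nu>\<delta> (g\<^sub>\<delta> * e)\<close>. Both are positive near 0, and these equations exclude a first zero. Since
  \<open>g\<^sub>1 = -e'\<close>, the total mass of \<open>g\<^sub>1\<close> is at most 1; the masses are multiplicative in \<open>\<delta>\<close> and nonzero,
  hence all finite.
\<close>

section \<open>Riemann-Liouville kernels, negative binomial coefficients and the series built from
  them\<close>

definition power_kernel :: "real \<Rightarrow> real \<Rightarrow> real" where
  "power_kernel b t = (if 0 < t then t powr (b - 1) / Gamma b else 0)"

text \<open>The coefficient of x^r in (1 - x)^(-\<delta>). For \<delta> > 0 it is the Gamma quotient
  in the Mittag-Leffler series; the pochhammer form also covers \<delta> = 0.\<close>

definition rising_coeff :: "real \<Rightarrow> nat \<Rightarrow> real" where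
  "rising_coeff \<delta> r = pochhammer \<delta> r / fact r"

text \<open>
  The Laplace transform of \<open>prabhakar \<nu> b \<delta>\<close> is \<open>z powr (\<nu>\<delta> - b) / (1 + z powr \<nu>) powr \<delta>\<close>, which
  suggests the convolution and differential identities used here.
\<close>

definition prabhakar :: "real \<Rightarrow> real \<Rightarrow> real \<Rightarrow> real \<Rightarrow> real" where
  "prabhakar \<nu> b \<delta> t = (\<Sum>r. (-1) ^ r * rising_coeff \<delta> r * power_kernel (\<nu> * real r + b) t)"

lemma power_kernel_nonneg: "0 < b \<Longrightarrow> 0 \<le> power_kernel b t"
  by (simp add: power_kernel_def Gamma_real_pos less_imp_le)

lemma power_kernel_measurable [measurable]: "power_kernel b \<in> borel_measurable borel"
  unfolding power_kernel_def by measurable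

text \<open>Semigroup law of fractional integration: the Beta integral, rescaled from (0,1) to
  (0,x). Since the kernels vanish for t \<le> 0, the integral over the whole line only sees
  (0,x).\<close>

lemma power_kernel_convolution:
  assumes "0 < a" "0 < b"
  shows "has_bochner_integral lborel (\<lambda>t. power_kernel a t * power_kernel b (x - t)) (power_kernel (a + b) x)"
proof (cases "0 < x")
  case False
  have "(\<lambda>t. power_kernel a t * power_kernel b (x - t)) = (\<lambda>t. 0)"
    using False by (auto simp: power_kernel_def fun_eq_iff)
  moreover have "power_kernel (a + b) x = 0"
    using False by (simp add: power_kernel_def)
  ultimately show ?thesis
    by (simp add: has_bochner_integral_zero)
next
  case True
  define f where "f t = (if t \<in> {0<..<1} then t powr (a - 1) * (1 - t) powr (b - 1) else 0)" for t :: real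
  have f_meas: "f \<in> borel_measurable borel"
    unfolding f_def by measurable
  have f_nonneg: "0 \<le> f t" for t
    by (simp add: f_def)
  have "((\<lambda>t. t powr (a - 1) * (1 - t) powr (b - 1)) has_integral Beta a b) {0<..<1}"
    using has_integral_Beta_real[OF assms] by (simp add: has_integral_Icc_iff_Ioo)
  then have "(f has_integral Beta a b) UNIV"
    unfolding f_def by (simp only: has_integral_restrict_UNIV)
  then have "(\<integral>\<^sup>+t. f t \<partial>lborel) = Beta a b"
    using nn_integral_has_integral_lborel f_meas f_nonneg by blast
  moreover have "0 \<le> Beta a b"
    using assms by (simp add: Beta_def Gamma_real_pos less_imp_le)
  ultimately have "has_bochner_integral lborel f (Beta a b)"
    using f_meas f_nonneg by (intro has_bochner_integral_nn_integral) auto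
  \<comment> \<open>Replacing the variable by t/x costs a factor x; the constant in the next step
    supplies the remaining power of x and the Gamma normalisation.\<close>
  then have "has_bochner_integral lborel (\<lambda>t. f (0 + (1/x) * t)) (Beta a b /\<^sub>R \<bar>1/x\<bar>)"
    using True by (subst lborel_has_bochner_integral_real_affine_iff[symmetric]) auto
  then have "has_bochner_integral lborel (\<lambda>t. (x powr (a + b - 2) / (Gamma a * Gamma b)) * f (0 + (1/x) * t))
      ((x powr (a + b - 2) / (Gamma a * Gamma b)) * (Beta a b /\<^sub>R \<bar>1/x\<bar>))"
    by (intro has_bochner_integral_mult_right) auto
  moreover have "(x powr (a + b - 2) / (Gamma a * Gamma b)) * f (0 + (1/x) * t)
      = power_kernel a t * power_kernel b (x - t)" for t
  proof (cases "0 < t \<and> t < x")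
    case t: True
    have "1 - t / x = (x - t) / x"
      using True by (simp add: field_simps)
    moreover have "x powr (a + b - 2) = x powr (a - 1) * x powr (b - 1)"
      using True by (simp add: powr_add[symmetric])
    ultimately show ?thesis
      using t True by (simp add: f_def power_kernel_def powr_divide)
  next
    case False
    then show ?thesis
      using True by (auto simp: f_def power_kernel_def field_simps)
  qed
  moreover have "(x powr (a + b - 2) / (Gamma a * Gamma b)) * (Beta a b /\<^sub>R \<bar>1/x\<bar>) = power_kernel (a + b) x"
  proof -
    have "x powr (a + b - 1) = x powr (a + b - 2) * x"
      using True powr_add[of x "a + b - 2" 1] by simp
    then show ?thesis
      using True assms Gamma_real_pos[of a, THEN less_imp_neq] Gamma_real_pos[of b, THEN less_imp_neq]
      by (simp add: power_kernel_def Beta_def)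
  qed
  ultimately show ?thesis
    by simp
qed

lemma rising_coeff_nonneg: "0 \<le> \<delta> \<Longrightarrow> 0 \<le> rising_coeff \<delta> r"
  by (simp add: rising_coeff_def pochhammer_prod prod_nonneg)

lemma rising_coeff_Suc: "rising_coeff \<delta> (Suc r) = rising_coeff \<delta> r * ((\<delta> + real r) / (real r + 1))"
  by (simp add: rising_coeff_def pochhammer_Suc field_simps)

lemma rising_coeff_0 [simp]: "rising_coeff \<delta> 0 = 1"
  by (simp add: rising_coeff_def)

lemma rising_coeff_zero [simp]: "rising_coeff 0 r = (if r = 0 then 1 else 0)"
  by (cases r) (auto simp: rising_coeff_def pochhammer_0_left)

lemma rising_coeff_one [simp]: "rising_coeff 1 r = 1"
  by (simp add: rising_coeff_def pochhammer_fact [symmetric])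

lemma rising_coeff_two [simp]: "rising_coeff 2 r = real r + 1"
  by (induction r) (simp_all add: rising_coeff_Suc field_simps)

lemma rising_coeff_plus1: "\<delta> * rising_coeff (\<delta> + 1) r = (\<delta> + real r) * rising_coeff \<delta> r"
  using pochhammer_rec[of \<delta> r] pochhammer_Suc[of \<delta> r]
  by (simp add: rising_coeff_def field_simps)

text \<open>Vandermonde's identity for rising factorials, that is, comparison of coefficients in (1
  - x)^(-\<delta>) (1 - x)^(-\<epsilon>).\<close>

lemma rising_coeff_convolution:
  "(\<Sum>i\<le>k. rising_coeff \<delta> i * rising_coeff \<epsilon> (k - i)) = rising_coeff (\<delta> + \<epsilon>) k"
  unfolding rising_coeff_def pochhammer_binomial_sum sum_divide_distrib
  by (intro sum.cong refl) (simp add: binomial_fact field_simps)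

text \<open>Log-convexity of Gamma: s is the convex combination of s + \<nu> and s + \<nu> - 1 with
  weights 1 - \<nu> and \<nu>, and the functional equation relates the two endpoint values. The
  bound drives the ratio test for the Mittag-Leffler series.\<close>

lemma Gamma_shift_bound:
  fixes s \<nu> :: real
  assumes "0 < \<nu>" "\<nu> \<le> 1" "1 < s"
  shows "Gamma s * (s + \<nu> - 1) powr \<nu> \<le> Gamma (s + \<nu>)"
proof -
  have pos: "0 < s + \<nu> - 1"
    using assms by simp
  have "(ln \<circ> Gamma) ((1 - \<nu>) *\<^sub>R (s + \<nu>) + \<nu> *\<^sub>R (s + \<nu> - 1))
      \<le> (1 - \<nu>) * (ln \<circ> Gamma) (s + \<nu>) + \<nu> * (ln \<circ> Gamma) (s + \<nu> - 1)"
    using assms by (intro convex_onD[OF log_convex_Gamma_real]) auto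
  moreover have "(1 - \<nu>) *\<^sub>R (s + \<nu>) + \<nu> *\<^sub>R (s + \<nu> - 1) = s"
    by (simp add: algebra_simps)
  moreover have "Gamma (s + \<nu>) = (s + \<nu> - 1) * Gamma (s + \<nu> - 1)"
    using Gamma_plus1[of "s + \<nu> - 1"] pos nonpos_Ints_nonpos[of "s + \<nu> - 1"] by force
  then have "ln (Gamma (s + \<nu>)) = ln (s + \<nu> - 1) + ln (Gamma (s + \<nu> - 1))"
    using ln_mult_pos[OF pos Gamma_real_pos[OF pos]] by (rule ssubst)
  ultimately have "ln (Gamma s) + \<nu> * ln (s + \<nu> - 1) \<le> ln (Gamma (s + \<nu>))"
    by (simp add: algebra_simps)
  then have "exp (ln (Gamma s) + \<nu> * ln (s + \<nu> - 1)) \<le> exp (ln (Gamma (s + \<nu>)))"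
    by simp
  then show ?thesis
    using pos assms by (simp add: exp_add Gamma_real_pos powr_def)
qed

lemma prabhakar_measurable [measurable]: "prabhakar \<nu> b \<delta> \<in> borel_measurable borel"
  unfolding prabhakar_def by measurable

lemma prabhakar_nonpos: "t \<le> 0 \<Longrightarrow> prabhakar \<nu> b \<delta> t = 0"
  by (simp add: prabhakar_def power_kernel_def)

text \<open>With this, integration from 0, which is convolution with \<open>power_kernel 1\<close>,
  becomes the case \<delta> = 0 of the convolution law for \<open>prabhakar\<close>.\<close>

lemma prabhakar_zero: "prabhakar \<nu> b 0 = power_kernel b"
proof
  fix t
  have "(-1) ^ r * rising_coeff 0 r * power_kernel (\<nu> * real r + b) t = (if r = 0 then power_kernel b t else 0)" for r
    by simp
  then show "prabhakar \<nu> b 0 t = power_kernel b t"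
    unfolding prabhakar_def using sums_single[of 0 "\<lambda>_. power_kernel b t"] by (simp only: sums_unique[symmetric])
qed

lemma mittag_leffler3_eq_powser:
  assumes "0 < \<delta>"
  shows "mittag_leffler3 \<nu> b \<delta> z = (\<Sum>r. rising_coeff \<delta> r / Gamma (\<nu> * real r + b) * z ^ r)"
proof -
  have "Gamma \<delta> \<noteq> 0"
    using Gamma_real_pos[OF assms] by simp
  moreover have "pochhammer \<delta> r = Gamma (\<delta> + real r) / Gamma \<delta>" for r
    using assms pochhammer_Gamma[of \<delta> r] nonpos_Ints_nonpos[of \<delta>] by force
  ultimately have "z ^ r / Gamma (\<nu> * real r + b) * (Gamma (\<delta> + real r) / (fact r * Gamma \<delta>))
      = rising_coeff \<delta> r / Gamma (\<nu> * real r + b) * z ^ r" for r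
    unfolding rising_coeff_def by (simp add: mult_ac)
  then show ?thesis
    by (simp only: mittag_leffler3_def)
qed

definition fgamma_density :: "real \<Rightarrow> real \<Rightarrow> real \<Rightarrow> real" where
  "fgamma_density \<nu> \<delta> = prabhakar \<nu> (\<nu> * \<delta>) \<delta>"

lemma fgamma_density_measurable [measurable]: "fgamma_density \<nu> \<delta> \<in> borel_measurable borel"
  unfolding fgamma_density_def by measurable

lemma fgamma_density_nonpos: "t \<le> 0 \<Longrightarrow> fgamma_density \<nu> \<delta> t = 0"
  by (simp add: fgamma_density_def prabhakar_nonpos)

section \<open>Criteria for strict positivity\<close>

lemma positive_by_continuation:
  fixes f :: "real \<Rightarrow> real"
  assumes cont: "\<And>t. 0 < t \<Longrightarrow> isCont f t"
    and near_0: "\<exists>d>0. \<forall>t\<in>{0<..<d}. 0 < f t"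
    and step: "\<And>a. 0 < a \<Longrightarrow> \<forall>t\<in>{0<..<a}. 0 < f t \<Longrightarrow> 0 < f a"
    and "0 < x"
  shows "0 < f x"
proof (rule ccontr)
  assume "\<not> 0 < f x"
  define S where "S = {t. 0 < t \<and> \<not> 0 < f t}"
  have S: "x \<in> S" "bdd_below S"
    using \<open>0 < x\<close> \<open>\<not> 0 < f x\<close> by (auto simp: S_def bdd_below_def intro!: exI[of _ 0])
  obtain d where d: "0 < d" "\<And>t. 0 < t \<Longrightarrow> t < d \<Longrightarrow> 0 < f t"
    using near_0 by auto
  have "d \<le> Inf S"
    using S d by (intro cInf_greatest) (auto simp: S_def not_less[symmetric])
  then have pos: "0 < Inf S"
    using d by simp
  have below: "0 < f t" if "0 < t" "t < Inf S" for t
    using that cInf_lower[of t S] S by (auto simp: S_def)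
  have "0 < f (Inf S)"
    using below pos by (intro step) auto
  then have "\<forall>\<^sub>F t in at (Inf S). 0 < f t"
    using cont[OF pos] order_tendstoD(1)[of f "f (Inf S)" "at (Inf S)" 0] unfolding isCont_def by simp
  then obtain e where e: "0 < e" "\<And>t. t \<noteq> Inf S \<Longrightarrow> dist t (Inf S) < e \<Longrightarrow> 0 < f t"
    unfolding eventually_at by auto
  \<comment> \<open>Positivity at the infimum spreads to a neighbourhood by continuity, so
    \<open>Inf S + e\<close> would be a larger lower bound of \<open>S\<close>.\<close>
  have "Inf S + e \<le> Inf S"
  proof (rule cInf_greatest)
    fix t assume t: "t \<in> S"
    show "Inf S + e \<le> t"
    proof (rule ccontr)
      assume "\<not> Inf S + e \<le> t"
      moreover have "Inf S \<le> t"
        using t S by (intro cInf_lower)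
      ultimately have "0 < f t"
        using e(2)[of t] \<open>0 < f (Inf S)\<close> by (cases "t = Inf S") (auto simp: dist_real_def)
      then show False
        using t by (simp add: S_def)
    qed
  qed (use S in auto)
  with e show False
    by simp
qed

lemma not_AE_avoids_interval:
  fixes a b :: real
  assumes "a < b"
  shows "\<not> (AE t in lborel. t \<notin> {a<..<b})"
proof
  assume "AE t in lborel. t \<notin> {a<..<b}"
  then have "emeasure lborel {a<..<b} = 0"
    using AE_iff_measurable[of "{a<..<b}" lborel "\<lambda>t. t \<notin> {a<..<b}"]
    by (simp del: greaterThanLessThan_iff)
  moreover have "emeasure lborel {a<..<b} = ennreal (b - a)"
    using assms by (intro emeasure_lborel_Ioo) simp
  ultimately show False
    using assms by simp
qed

text \<open>The integrand is positive on (0,a) and zero elsewhere, so a vanishing integral would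
  make (0,a) a null set. Only values strictly before a enter, which is what the step of
  \<open>positive_by_continuation\<close> provides.\<close>

lemma convolution_pos:
  fixes f k :: "real \<Rightarrow> real"
  assumes I: "has_bochner_integral lborel (\<lambda>t. f t * k (a - t)) I"
    and "0 < a" and pos: "\<And>t. 0 < t \<Longrightarrow> t < a \<Longrightarrow> 0 < f t \<and> 0 < k t"
    and zero: "\<And>t. t \<le> 0 \<Longrightarrow> f t = 0 \<and> k t = 0"
  shows "0 < I"
proof -
  let ?h = "\<lambda>t. f t * k (a - t)"
  have h_pos: "0 < ?h t" if "0 < t" "t < a" for t
    using that pos[of t] pos[of "a - t"] by simp
  have h_nonneg: "0 \<le> ?h t" for t
    using h_pos[of t] zero[of t] zero[of "a - t"] by (cases "0 < t"; cases "t < a") auto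
  have int: "integrable lborel ?h" and I_eq: "integral\<^sup>L lborel ?h = I"
    using I by (auto simp: has_bochner_integral_iff)
  have "I \<noteq> 0"
  proof
    assume "I = 0"
    then have "AE t in lborel. ?h t = 0"
      using integral_nonneg_eq_0_iff_AE[OF int] I_eq h_nonneg by simp
    then have "AE t in lborel. t \<notin> {0<..<a}"
    proof eventually_elim
      case (elim t)
      then show ?case
        using h_pos[of t] by auto
    qed
    then show False
      using not_AE_avoids_interval[OF \<open>0 < a\<close>] by simp
  qed
  moreover have "0 \<le> I"
    unfolding I_eq[symmetric] by (rule Bochner_Integration.integral_nonneg) (rule h_nonneg)
  ultimately show ?thesis
    by simp
qed

text \<open>The functional equation of Gamma. On the Laplace side, multiplication by t is minus the
  derivative, here of z^(-b).\<close>

lemma power_kernel_times_self: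
  assumes "0 < b"
  shows "t * power_kernel b t = b * power_kernel (b + 1) t"
proof -
  have "Gamma (b + 1) = b * Gamma b"
    using Gamma_plus1[of b] nonpos_Ints_nonpos[of b] assms by force
  moreover have "t powr b = t * t powr (b - 1)" if "0 < t"
    using that powr_add[of t 1 "b - 1"] by simp
  ultimately show ?thesis
    using assms by (simp add: power_kernel_def)
qed

text \<open>For s = 1 this is the joint density of the proportions q and the total y of independent
  fractional Gamma variables; \<open>y ^ card J\<close> is the Jacobian. The remaining coordinate is
  s minus the others, with shape c; a general s is what is left after other coordinates have been
  fixed. The cutoff at y = 0 matters, since a product of two negative numbers would otherwise be a
  positive argument.\<close>

definition dirichlet_integrand ::
  "real \<Rightarrow> 'i set \<Rightarrow> ('i \<Rightarrow> real) \<Rightarrow> real \<Rightarrow> real \<Rightarrow> ('i \<Rightarrow> real) \<Rightarrow> real \<Rightarrow> real" where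
  "dirichlet_integrand \<nu> J \<beta> c s q y =
     (if 0 < y then y ^ card J * (\<Prod>j\<in>J. fgamma_density \<nu> (\<beta> j) (y * q j))
                    * fgamma_density \<nu> c (y * (s - (\<Sum>j\<in>J. q j))) else 0)"

lemma dirichlet_integrand_measurable [measurable]:
  assumes [measurable]: "g \<in> borel_measurable N" "\<And>j. j \<in> J \<Longrightarrow> (\<lambda>p. f p j) \<in> borel_measurable N"
  shows "(\<lambda>p. dirichlet_integrand \<nu> J \<beta> c s (f p) (g p)) \<in> borel_measurable N"
  unfolding dirichlet_integrand_def by measurable

text \<open>Fixing one coordinate at x leaves the total s - x for the others and splits off one
  Jacobian factor y.\<close>

lemma dirichlet_integrand_insert:
  assumes "finite J" "i \<notin> J"
  shows "dirichlet_integrand \<nu> (insert i J) \<beta> c s (q(i := x)) y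
    = (y * fgamma_density \<nu> (\<beta> i) (y * x)) * dirichlet_integrand \<nu> J \<beta> c (s - x) q y"
proof -
  have "(\<Prod>j\<in>J. fgamma_density \<nu> (\<beta> j) (y * (q(i := x)) j)) = (\<Prod>j\<in>J. fgamma_density \<nu> (\<beta> j) (y * q j))"
    using assms by (intro prod.cong) auto
  moreover have "(\<Sum>j\<in>J. (q(i := x)) j) = (\<Sum>j\<in>J. q j)"
    using assms by (intro sum.cong) auto
  ultimately show ?thesis
    using assms by (simp add: dirichlet_integrand_def diff_diff_eq del: fun_upd_apply) (simp add: mult_ac)
qed

section \<open>Convergence of the series for \<nu> in (0,1]\<close>

context
  fixes \<nu> :: real
  assumes \<nu>: "0 < \<nu>" "\<nu> \<le> 1"
begin

text \<open>Ratio test: quotients of consecutive coefficients \<open>rising_coeff \<delta> r\<close>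
  stay bounded, while by \<open>Gamma_shift_bound\<close> the Gamma quotients grow without
  bound.\<close>

lemma prabhakar_powser_summable:
  assumes "0 < b" "0 \<le> \<delta>"
  shows "summable (\<lambda>r. rising_coeff \<delta> r / Gamma (\<nu> * real r + b) * y ^ r)"
proof -
  \<comment> \<open>An upper bound for \<bar>y\<bar> (\<delta> + r) / (r + 1), uniform in r; a Gamma
    quotient of at least \<open>2 * C\<close> then gives the ratio 1/2.\<close>
  define C where "C = \<bar>y\<bar> * (1 + \<delta>)"
  have "filterlim (\<lambda>r. (\<nu> * real r + b + \<nu> - 1) powr \<nu>) at_top at_top"
    using \<nu> by real_asymp
  then have "\<forall>\<^sub>F r in sequentially. 2 * C \<le> (\<nu> * real r + b + \<nu> - 1) powr \<nu>"
    by (simp add: filterlim_at_top)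
  moreover have "filterlim (\<lambda>r. \<nu> * real r + b) at_top at_top"
    using \<nu> by real_asymp
  then have "\<forall>\<^sub>F r in sequentially. 1 < \<nu> * real r + b"
    by (simp add: filterlim_at_top_dense)
  ultimately have "\<forall>\<^sub>F r in sequentially. 2 * C \<le> (\<nu> * real r + b + \<nu> - 1) powr \<nu> \<and> 1 < \<nu> * real r + b"
    by (rule eventually_conj)
  then obtain N where N: "\<And>r. N \<le> r \<Longrightarrow> 2 * C \<le> (\<nu> * real r + b + \<nu> - 1) powr \<nu>"
      "\<And>r. N \<le> r \<Longrightarrow> 1 < \<nu> * real r + b"
    unfolding eventually_sequentially by blast
  show ?thesis
  proof (rule summable_ratio_test[of "1/2" N])
    fix r assume r: "N \<le> r"
    let ?s = "\<nu> * real r + b"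
    have s: "0 < ?s" "0 < ?s + \<nu>"
      using N(2)[OF r] \<nu> by auto
    have G: "0 < Gamma ?s" "0 < Gamma (?s + \<nu>)"
      using s by (auto intro: Gamma_real_pos)
    have "2 * C * Gamma ?s \<le> (?s + \<nu> - 1) powr \<nu> * Gamma ?s"
      using N(1)[OF r] G by (intro mult_right_mono) auto
    also have "\<dots> \<le> Gamma (?s + \<nu>)"
      using Gamma_shift_bound[OF \<nu> N(2)[OF r]] by (simp add: mult.commute)
    finally have le: "C / Gamma (?s + \<nu>) \<le> 1/2 / Gamma ?s"
      using G by (simp add: field_simps)
    have "(\<delta> + real r) / (real r + 1) \<le> 1 + \<delta>"
      using assms by (simp add: field_simps)
    then have "\<bar>y\<bar> * ((\<delta> + real r) / (real r + 1)) \<le> C"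
      unfolding C_def by (intro mult_left_mono) auto
    then have "\<bar>y\<bar> * ((\<delta> + real r) / (real r + 1)) / Gamma (?s + \<nu>) \<le> C / Gamma (?s + \<nu>)"
      using G by (intro divide_right_mono) auto
    also note le
    finally have le: "\<bar>y\<bar> * ((\<delta> + real r) / (real r + 1)) / Gamma (?s + \<nu>) \<le> 1/2 / Gamma ?s" .
    have shift: "\<nu> * real (Suc r) + b = ?s + \<nu>"
      by (simp add: algebra_simps)
    have "norm (rising_coeff \<delta> (Suc r) / Gamma (\<nu> * real (Suc r) + b) * y ^ Suc r)
      = (rising_coeff \<delta> r * \<bar>y\<bar> ^ r) * (\<bar>y\<bar> * ((\<delta> + real r) / (real r + 1)) / Gamma (?s + \<nu>))"
      unfolding shift using G assms rising_coeff_nonneg[OF assms(2), of r]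
      by (simp add: rising_coeff_Suc abs_mult power_abs)
    also have "\<dots> \<le> (rising_coeff \<delta> r * \<bar>y\<bar> ^ r) * (1/2 / Gamma ?s)"
      using le rising_coeff_nonneg[OF assms(2), of r] by (intro mult_left_mono) auto
    also have "\<dots> = 1/2 * norm (rising_coeff \<delta> r / Gamma ?s * y ^ r)"
      using G rising_coeff_nonneg[OF assms(2), of r] by (simp add: abs_mult power_abs)
    finally show "norm (rising_coeff \<delta> (Suc r) / Gamma (\<nu> * real (Suc r) + b) * y ^ Suc r)
      \<le> 1/2 * norm (rising_coeff \<delta> r / Gamma ?s * y ^ r)" .
  qed simp
qed

lemma power_kernel_powser:
  assumes "0 < t"
  shows "power_kernel (\<nu> * real r + b) t = t powr (b - 1) * ((t powr \<nu>) ^ r / Gamma (\<nu> * real r + b))"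
proof -
  have "t powr (\<nu> * real r + b - 1) = t powr (b - 1) * t powr (\<nu> * real r)"
    by (simp add: powr_add[symmetric] algebra_simps)
  also have "t powr (\<nu> * real r) = (t powr \<nu>) ^ r"
    using assms by (simp add: powr_powr[symmetric] powr_realpow)
  finally show ?thesis
    using assms by (simp add: power_kernel_def)
qed

lemma prabhakar_summable:
  assumes "0 < b" "0 \<le> \<delta>"
  shows "summable (\<lambda>r. rising_coeff \<delta> r * power_kernel (\<nu> * real r + b) t)"
proof (cases "0 < t")
  case True
  then show ?thesis
    using summable_mult[OF prabhakar_powser_summable[OF assms, of "t powr \<nu>"], of "t powr (b - 1)"]
    by (simp add: power_kernel_powser mult_ac)
qed (simp add: power_kernel_def)

lemma abs_prabhakar_term:
  assumes "0 < b" "0 \<le> \<delta>"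
  shows "\<bar>(-1) ^ r * rising_coeff \<delta> r * power_kernel (\<nu> * real r + b) t\<bar>
    = rising_coeff \<delta> r * power_kernel (\<nu> * real r + b) t"
  using assms \<nu> by (simp add: abs_mult rising_coeff_nonneg power_kernel_nonneg add_nonneg_pos)

lemma prabhakar_sums:
  assumes "0 < b" "0 \<le> \<delta>"
  shows "(\<lambda>r. (-1) ^ r * rising_coeff \<delta> r * power_kernel (\<nu> * real r + b) t) sums prabhakar \<nu> b \<delta> t"
  unfolding prabhakar_def
  by (intro summable_sums, rule summable_norm_cancel)
    (simp only: real_norm_def abs_prabhakar_term[OF assms] prabhakar_summable[OF assms])

lemma prabhakar_powser:
  assumes "0 < b" "0 \<le> \<delta>" "0 < t"
  shows "prabhakar \<nu> b \<delta> t = t powr (b - 1) * (\<Sum>r. rising_coeff \<delta> r / Gamma (\<nu> * real r + b) * (- (t powr \<nu>)) ^ r)"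
proof -
  have "(-1) ^ r * rising_coeff \<delta> r * power_kernel (\<nu> * real r + b) t =
    t powr (b - 1) * (rising_coeff \<delta> r / Gamma (\<nu> * real r + b) * (- (t powr \<nu>)) ^ r)" for r
    unfolding power_kernel_powser[OF assms(3)] power_minus[of "t powr \<nu>" r] by simp
  then show ?thesis
    unfolding prabhakar_def by (simp only: suminf_mult[OF prabhakar_powser_summable[OF assms(1,2)]])
qed

section \<open>Convolution of the series\<close>

text \<open>Cauchy product integrated term by term: along i + j = k every pair of kernels convolves
  to the same kernel, so the coefficients combine by
  \<open>rising_coeff_convolution\<close>.\<close>

lemma prabhakar_convolution:
  assumes "0 < b" "0 \<le> \<delta>" "0 < c" "0 \<le> \<epsilon>"
  shows "has_bochner_integral lborel (\<lambda>t. prabhakar \<nu> b \<delta> t * prabhakar \<nu> c \<epsilon> (x - t)) (prabhakar \<nu> (b + c) (\<delta> + \<epsilon>) x)"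
proof -
  let ?p = "\<lambda>r. power_kernel (\<nu> * real r + b)" and ?q = "\<lambda>r. power_kernel (\<nu> * real r + c)"
  let ?a = "rising_coeff \<delta>" and ?d = "rising_coeff \<epsilon>"
  define A where "A r t = (-1) ^ r * ?a r * ?p r t" for r t
  define D where "D r t = (-1) ^ r * ?d r * ?q r t" for r t
  \<comment> \<open>\<open>F k\<close> is the k-th diagonal of the Cauchy product and
    \<open>G k\<close> its majorant by absolute values. The integrals \<open>?R k\<close> of
    \<open>G k\<close> again form a convergent series of the same kind, which justifies exchanging
    sum and integral.\<close>
  define F where "F k t = (\<Sum>i\<le>k. A i t * D (k - i) (x - t))" for k t
  define G where "G k t = (\<Sum>i\<le>k. (?a i * ?p i t) * (?d (k - i) * ?q (k - i) (x - t)))" for k t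
  let ?R = "\<lambda>k. rising_coeff (\<delta> + \<epsilon>) k * power_kernel (\<nu> * real k + (b + c)) x"
  have absA: "\<bar>A r t\<bar> = ?a r * ?p r t" and absD: "\<bar>D r t\<bar> = ?d r * ?q r t" for r t
    unfolding A_def D_def using assms by (simp_all only: abs_prabhakar_term)
  have pq: "has_bochner_integral lborel (\<lambda>t. ?p i t * ?q (k - i) (x - t)) (power_kernel (\<nu> * real k + (b + c)) x)"
    if "i \<le> k" for i k
  proof -
    have "has_bochner_integral lborel (\<lambda>t. ?p i t * ?q (k - i) (x - t))
        (power_kernel (\<nu> * real i + b + (\<nu> * real (k - i) + c)) x)"
      using assms \<nu> by (intro power_kernel_convolution add_nonneg_pos) auto
    then show ?thesis
      using that by (simp add: of_nat_diff algebra_simps)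
  qed
  have G: "has_bochner_integral lborel (G k) (?R k)" for k
  proof -
    have "has_bochner_integral lborel (\<lambda>t. \<Sum>i\<le>k. (?a i * ?d (k - i)) * (?p i t * ?q (k - i) (x - t)))
        (\<Sum>i\<le>k. (?a i * ?d (k - i)) * power_kernel (\<nu> * real k + (b + c)) x)"
      by (intro has_bochner_integral_sum has_bochner_integral_mult_right pq) auto
    then show ?thesis
      unfolding sum_distrib_right[symmetric] rising_coeff_convolution G_def by (simp add: mult_ac)
  qed
  have F: "has_bochner_integral lborel (F k) ((-1) ^ k * ?R k)" for k
  proof -
    have "A i t * D (k - i) (x - t) = (-1) ^ k * ((?a i * ?d (k - i)) * (?p i t * ?q (k - i) (x - t)))"
      if "i \<le> k" for i t
      using that unfolding A_def D_def by (simp add: mult_ac power_add[symmetric])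
    then have "F k t = (-1) ^ k * G k t" for t
      unfolding F_def G_def sum_distrib_left by (intro sum.cong) (simp_all add: mult_ac)
    then show ?thesis
      using has_bochner_integral_mult_right[of "(-1) ^ k", OF G[of k]] by presburger
  qed
  have FG: "norm (F k t) \<le> G k t" for k t
    unfolding F_def G_def by (rule order_trans[OF norm_sum]) (simp add: abs_mult absA absD)
  have summable_G: "summable (\<lambda>k. G k t)" for t
    unfolding G_def
    by (rule summable_Cauchy_product)
      (use assms \<nu> in \<open>simp_all add: abs_mult rising_coeff_nonneg power_kernel_nonneg add_nonneg_pos prabhakar_summable\<close>)
  have summable_F: "summable (\<lambda>k. norm (F k t))" for t
    by (rule summable_comparison_test'[OF summable_G[of t], of 0]) (use FG in auto)
  have "(LINT t|lborel. norm (F k t)) \<le> ?R k" for k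
    using integral_mono[OF integrable_norm[OF integrable.intros[OF F[of k]]] integrable.intros[OF G[of k]] FG]
      has_bochner_integral_integral_eq[OF G[of k]] by simp
  moreover have "summable ?R"
    using assms by (intro prabhakar_summable) auto
  ultimately have int_F: "summable (\<lambda>k. LINT t|lborel. norm (F k t))"
    by (auto intro: summable_comparison_test'[where N = 0 and g = ?R])
  have prod: "prabhakar \<nu> b \<delta> t * prabhakar \<nu> c \<epsilon> (x - t) = (\<Sum>k. F k t)" for t
  proof -
    have "prabhakar \<nu> b \<delta> t * prabhakar \<nu> c \<epsilon> (x - t) = (\<Sum>k. A k t) * (\<Sum>k. D k (x - t))"
      by (simp add: prabhakar_def A_def D_def)
    also have "\<dots> = (\<Sum>k. F k t)"
      unfolding F_def using assms
      by (intro Cauchy_product) (simp_all add: absA absD prabhakar_summable)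
    finally show ?thesis .
  qed
  have int: "integrable lborel (F k)" for k
    using F integrable.intros by blast
  have "integrable lborel (\<lambda>t. \<Sum>k. F k t)"
    using summable_F int_F int by (intro integrable_suminf) auto
  moreover have "(LINT t|lborel. (\<Sum>k. F k t)) = (\<Sum>k. LINT t|lborel. F k t)"
    using summable_F int_F int by (intro integral_suminf) auto
  ultimately show ?thesis
    unfolding prod has_bochner_integral_iff has_bochner_integral_integral_eq[OF F] by (simp add: prabhakar_def mult_ac)
qed

lemma prabhakar_eq_mittag_leffler3:
  assumes "0 < b" "0 < \<delta>" "0 < t"
  shows "prabhakar \<nu> b \<delta> t = t powr (b - 1) * mittag_leffler3 \<nu> b \<delta> (- (t powr \<nu>))"
  using assms by (simp only: prabhakar_powser mittag_leffler3_eq_powser less_imp_le)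

text \<open>A power series converging everywhere, evaluated at -(t^\<nu>), times t^(b-1); the latter
  may be singular at 0, hence t > 0.\<close>

lemma isCont_prabhakar:
  assumes "0 < b" "0 \<le> \<delta>" "0 < t"
  shows "isCont (prabhakar \<nu> b \<delta>) t"
proof -
  have "isCont (\<lambda>t. t powr (b - 1) * (\<Sum>r. rising_coeff \<delta> r / Gamma (\<nu> * real r + b) * (- (t powr \<nu>)) ^ r)) t"
    using assms
    by (intro isCont_mult isCont_o2[OF _ isCont_powser_converges_everywhere] prabhakar_powser_summable)
      (auto intro!: continuous_intros)
  moreover have "\<forall>\<^sub>F s in nhds t. prabhakar \<nu> b \<delta> s =
      s powr (b - 1) * (\<Sum>r. rising_coeff \<delta> r / Gamma (\<nu> * real r + b) * (- (s powr \<nu>)) ^ r)"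
    using eventually_nhds_in_open[of "{0<..}" t] assms
    by (auto elim!: eventually_mono simp: prabhakar_powser)
  ultimately show ?thesis
    using isCont_cong[of "prabhakar \<nu> b \<delta>" _ t] by simp
qed

text \<open>After division by t^(b-1) the series tends to its constant term 1 / Gamma(b) as t
  decreases to 0.\<close>

lemma prabhakar_pos_near_0:
  assumes "0 < b" "0 \<le> \<delta>"
  shows "\<exists>d>0. \<forall>t\<in>{0<..<d}. 0 < prabhakar \<nu> b \<delta> t"
proof -
  let ?f = "\<lambda>z. \<Sum>r. rising_coeff \<delta> r / Gamma (\<nu> * real r + b) * z ^ r"
  have "isCont ?f 0"
    using assms by (intro isCont_powser_converges_everywhere prabhakar_powser_summable)
  moreover have "((\<lambda>t. - (t powr \<nu>)) \<longlongrightarrow> 0) (at_right 0)"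
    using \<nu> by real_asymp
  ultimately have "((\<lambda>t. ?f (- (t powr \<nu>))) \<longlongrightarrow> ?f 0) (at_right 0)"
    by (rule isCont_tendsto_compose)
  moreover have "?f 0 > 0"
    using assms unfolding powser_zero by (simp add: Gamma_real_pos)
  ultimately have "\<forall>\<^sub>F t in at_right 0. 0 < ?f (- (t powr \<nu>))"
    by (rule order_tendstoD)
  then obtain d where "0 < d" "\<And>t. 0 < t \<Longrightarrow> t < d \<Longrightarrow> 0 < ?f (- (t powr \<nu>))"
    unfolding eventually_at_right_field by auto
  then show ?thesis
    using assms by (intro exI[of _ d]) (auto simp: prabhakar_powser)
qed

section \<open>Positivity and integrability of the fractional Gamma densities\<close>

text \<open>
  This is the logarithmic derivative of the Laplace transform \<open>z powr (\<nu> - 1) / (1 + z powr \<nu>)\<close>.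
\<close>

lemma relaxation_equation:
  "t * prabhakar \<nu> 1 1 t = (1 - \<nu>) * prabhakar \<nu> 2 1 t + \<nu> * prabhakar \<nu> 2 2 t"
proof -
  let ?k = "\<lambda>r. power_kernel (\<nu> * real r + 2) t"
  \<comment> \<open>Termwise this is \<open>\<nu> * r + 1 = (1 - \<nu>) + \<nu> * (r + 1)\<close>,
    with 1 and r + 1 the coefficients for \<delta> = 1 and \<delta> = 2.\<close>
  have eq: "t * ((-1) ^ r * rising_coeff 1 r * power_kernel (\<nu> * real r + 1) t)
      = (1 - \<nu>) * ((-1) ^ r * rising_coeff 1 r * ?k r) + \<nu> * ((-1) ^ r * rising_coeff 2 r * ?k r)" for r
  proof -
    have "t * power_kernel (\<nu> * real r + 1) t = (\<nu> * real r + 1) * ?k r"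
      using power_kernel_times_self[of "\<nu> * real r + 1" t] add_nonneg_pos[of "\<nu> * real r" 1] \<nu>
      by (simp add: add.assoc)
    then have "t * ((-1) ^ r * rising_coeff 1 r * power_kernel (\<nu> * real r + 1) t)
        = (-1) ^ r * rising_coeff 1 r * ((\<nu> * real r + 1) * ?k r)"
      by (metis mult.left_commute)
    then show ?thesis
      by (simp add: algebra_simps)
  qed
  have "(\<lambda>r. t * ((-1) ^ r * rising_coeff 1 r * power_kernel (\<nu> * real r + 1) t)) sums (t * prabhakar \<nu> 1 1 t)"
    by (intro sums_mult prabhakar_sums) auto
  moreover have "(\<lambda>r. t * ((-1) ^ r * rising_coeff 1 r * power_kernel (\<nu> * real r + 1) t)) sums
      ((1 - \<nu>) * prabhakar \<nu> 2 1 t + \<nu> * prabhakar \<nu> 2 2 t)"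
    unfolding eq by (intro sums_add sums_mult prabhakar_sums) auto
  ultimately show ?thesis
    by (rule sums_unique2)
qed

lemma relaxation_pos:
  assumes "0 < t"
  shows "0 < prabhakar \<nu> 1 1 t"
proof (rule positive_by_continuation[OF _ _ _ assms])
  fix a :: real
  assume a: "0 < a" and IH: "\<forall>t\<in>{0<..<a}. 0 < prabhakar \<nu> 1 1 t"
  \<comment> \<open>The sums stay unevaluated so that the convolution law splits them: here e * e,
    and below, with \<open>1 + 0\<close>, the convolution of e with the constant 1.\<close>
  have "0 < prabhakar \<nu> (1 + 1) (1 + 1) a"
    by (rule convolution_pos[OF prabhakar_convolution]) (use a IH in \<open>auto simp: prabhakar_nonpos\<close>)
  moreover have "0 < prabhakar \<nu> (1 + 1) (1 + 0) a"
    by (rule convolution_pos[OF prabhakar_convolution])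
      (use a IH in \<open>auto simp: prabhakar_nonpos prabhakar_zero power_kernel_def\<close>)
  ultimately have "0 < a * prabhakar \<nu> 1 1 a"
    unfolding relaxation_equation using \<nu> by (simp add: add_nonneg_pos)
  then show "0 < prabhakar \<nu> 1 1 a"
    using a by (simp add: zero_less_mult_iff)
qed (auto intro: isCont_prabhakar prabhakar_pos_near_0)

text \<open>The derivative of the Laplace transform (1 + z^\<nu>)^(-\<delta>), up to sign. By the
  convolution law the right-hand side is \<nu>\<delta> times the convolution of the density with
  \<open>prabhakar \<nu> 1 1\<close>.\<close>

lemma fgamma_density_equation:
  assumes "0 < \<delta>"
  shows "t * fgamma_density \<nu> \<delta> t = \<nu> * \<delta> * prabhakar \<nu> (\<nu> * \<delta> + 1) (\<delta> + 1) t"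
proof -
  let ?k = "\<lambda>r. power_kernel (\<nu> * real r + (\<nu> * \<delta> + 1)) t"
  have eq: "t * ((-1) ^ r * rising_coeff \<delta> r * power_kernel (\<nu> * real r + \<nu> * \<delta>) t)
      = \<nu> * \<delta> * ((-1) ^ r * rising_coeff (\<delta> + 1) r * ?k r)" for r
  proof -
    have "t * power_kernel (\<nu> * real r + \<nu> * \<delta>) t = (\<nu> * real r + \<nu> * \<delta>) * ?k r"
      using power_kernel_times_self[of "\<nu> * real r + \<nu> * \<delta>" t] add_nonneg_pos[of "\<nu> * real r" "\<nu> * \<delta>"] \<nu> assms
      by (simp add: add.assoc)
    then have "t * ((-1) ^ r * rising_coeff \<delta> r * power_kernel (\<nu> * real r + \<nu> * \<delta>) t)
        = (-1) ^ r * rising_coeff \<delta> r * ((\<nu> * real r + \<nu> * \<delta>) * ?k r)"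
      by (metis mult.left_commute)
    also have "\<dots> = (-1) ^ r * \<nu> * ((\<delta> + real r) * rising_coeff \<delta> r) * ?k r"
      by (simp add: algebra_simps)
    finally show ?thesis
      unfolding rising_coeff_plus1[symmetric] by (simp only: mult_ac)
  qed
  have "(\<lambda>r. t * ((-1) ^ r * rising_coeff \<delta> r * power_kernel (\<nu> * real r + \<nu> * \<delta>) t)) sums (t * fgamma_density \<nu> \<delta> t)"
    unfolding fgamma_density_def using assms \<nu> by (intro sums_mult prabhakar_sums) auto
  moreover have "(\<lambda>r. t * ((-1) ^ r * rising_coeff \<delta> r * power_kernel (\<nu> * real r + \<nu> * \<delta>) t)) sums
      (\<nu> * \<delta> * prabhakar \<nu> (\<nu> * \<delta> + 1) (\<delta> + 1) t)"
    unfolding eq using assms \<nu> by (intro sums_mult prabhakar_sums) (auto intro: add_pos_pos)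
  ultimately show ?thesis
    by (rule sums_unique2)
qed

lemma fgamma_density_pos:
  assumes "0 < \<delta>" "0 < t"
  shows "0 < fgamma_density \<nu> \<delta> t"
proof (rule positive_by_continuation[OF _ _ _ assms(2)])
  fix a :: real
  assume a: "0 < a" and IH: "\<forall>t\<in>{0<..<a}. 0 < fgamma_density \<nu> \<delta> t"
  have "0 < prabhakar \<nu> (\<nu> * \<delta> + 1) (\<delta> + 1) a"
    by (rule convolution_pos[OF prabhakar_convolution])
      (use a IH assms \<nu> relaxation_pos in \<open>auto simp: prabhakar_nonpos fgamma_density_def\<close>)
  then have "0 < a * fgamma_density \<nu> \<delta> a"
    unfolding fgamma_density_equation[OF assms(1)] using \<nu> assms by simp
  then show "0 < fgamma_density \<nu> \<delta> a"
    using a by (simp add: zero_less_mult_iff)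
qed (use assms \<nu> in \<open>auto simp: fgamma_density_def intro: isCont_prabhakar prabhakar_pos_near_0\<close>)

lemma fgamma_density_nonneg: "0 < \<delta> \<Longrightarrow> 0 \<le> fgamma_density \<nu> \<delta> t"
  using fgamma_density_pos[of \<delta> t] fgamma_density_nonpos[of t \<nu> \<delta>] by (cases "0 < t") auto

lemma fgamma_density_convolution:
  assumes "0 < \<delta>" "0 < \<epsilon>"
  shows "(\<integral>\<^sup>+t. ennreal (fgamma_density \<nu> \<delta> t) * ennreal (fgamma_density \<nu> \<epsilon> (x - t)) \<partial>lborel)
    = ennreal (fgamma_density \<nu> (\<delta> + \<epsilon>) x)"
proof -
  have "has_bochner_integral lborel (\<lambda>t. fgamma_density \<nu> \<delta> t * fgamma_density \<nu> \<epsilon> (x - t)) (fgamma_density \<nu> (\<delta> + \<epsilon>) x)"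
    using prabhakar_convolution[of "\<nu> * \<delta>" \<delta> "\<nu> * \<epsilon>" \<epsilon> x] assms \<nu>
    by (simp add: fgamma_density_def ring_distribs)
  then have "(\<integral>\<^sup>+t. ennreal (fgamma_density \<nu> \<delta> t * fgamma_density \<nu> \<epsilon> (x - t)) \<partial>lborel)
      = ennreal (fgamma_density \<nu> (\<delta> + \<epsilon>) x)"
    using assms by (simp add: has_bochner_integral_iff nn_integral_eq_integral fgamma_density_nonneg)
  then show ?thesis
    using assms by (simp add: ennreal_mult fgamma_density_nonneg)
qed

text \<open>Tonelli and translation invariance turn the convolution law into multiplicativity of the
  masses. Finiteness is not presupposed, as it is derived from this.\<close>

lemma nn_integral_fgamma_density_add:
  assumes "0 < \<delta>" "0 < \<epsilon>"
  shows "(\<integral>\<^sup>+t. ennreal (fgamma_density \<nu> (\<delta> + \<epsilon>) t) \<partial>lborel)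
    = (\<integral>\<^sup>+t. ennreal (fgamma_density \<nu> \<delta> t) \<partial>lborel) * (\<integral>\<^sup>+t. ennreal (fgamma_density \<nu> \<epsilon> t) \<partial>lborel)"
proof -
  let ?f = "\<lambda>t. ennreal (fgamma_density \<nu> \<delta> t)" and ?g = "\<lambda>t. ennreal (fgamma_density \<nu> \<epsilon> t)"
  have "(\<integral>\<^sup>+x. ennreal (fgamma_density \<nu> (\<delta> + \<epsilon>) x) \<partial>lborel) = (\<integral>\<^sup>+x. \<integral>\<^sup>+t. ?f t * ?g (x - t) \<partial>lborel \<partial>lborel)"
    using assms by (simp add: fgamma_density_convolution)
  also have "\<dots> = (\<integral>\<^sup>+t. \<integral>\<^sup>+x. ?f t * ?g (x - t) \<partial>lborel \<partial>lborel)"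
    by (rule lborel_pair.Fubini') measurable
  also have "\<dots> = (\<integral>\<^sup>+t. ?f t * (\<integral>\<^sup>+x. ?g x \<partial>lborel) \<partial>lborel)"
  proof (rule nn_integral_cong)
    fix t
    have "(\<integral>\<^sup>+x. ?g x \<partial>lborel) = (\<integral>\<^sup>+x. ?g (x - t) \<partial>lborel)"
      using nn_integral_real_affine[of ?g 1 "- t"] by simp
    then show "(\<integral>\<^sup>+x. ?f t * ?g (x - t) \<partial>lborel) = ?f t * (\<integral>\<^sup>+x. ?g x \<partial>lborel)"
      by (simp add: nn_integral_cmult)
  qed
  also have "\<dots> = (\<integral>\<^sup>+t. ?f t \<partial>lborel) * (\<integral>\<^sup>+t. ?g t \<partial>lborel)"
    by (rule nn_integral_multc) measurable
  finally show ?thesis .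
qed

text \<open>For x > 0 the term r = 0 of \<open>prabhakar \<nu> 1 1 x\<close> is 1; the other terms,
  shifted by one index, form the left-hand series with opposite sign. That series is the integral of
  \<open>fgamma_density \<nu> 1\<close> up to x.\<close>

lemma fgamma_density_one_cdf:
  assumes "0 < x"
  shows "prabhakar \<nu> (\<nu> + 1) 1 x = 1 - prabhakar \<nu> 1 1 x"
proof -
  let ?a = "\<lambda>r. (-1) ^ r * rising_coeff 1 r * power_kernel (\<nu> * real r + 1) x"
  have "?a sums prabhakar \<nu> 1 1 x"
    by (intro prabhakar_sums) auto
  then have "(\<lambda>r. ?a (Suc r)) sums (prabhakar \<nu> 1 1 x - 1)"
    using assms by (subst sums_Suc_iff) (simp add: power_kernel_def)
  from sums_minus[OF this] have "(\<lambda>r. (-1) ^ r * rising_coeff 1 r * power_kernel (\<nu> * real r + (\<nu> + 1)) x) sums (1 - prabhakar \<nu> 1 1 x)"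
    by (simp add: algebra_simps)
  moreover have "(\<lambda>r. (-1) ^ r * rising_coeff 1 r * power_kernel (\<nu> * real r + (\<nu> + 1)) x) sums prabhakar \<nu> (\<nu> + 1) 1 x"
    using \<nu> by (intro prabhakar_sums) auto
  ultimately show ?thesis
    by (rule sums_unique2[symmetric])
qed

lemma nn_integral_fgamma_density_one: "(\<integral>\<^sup>+t. ennreal (fgamma_density \<nu> 1 t) \<partial>lborel) \<le> 1"
proof -
  let ?g = "fgamma_density \<nu> 1"
  define F where "F n t = ennreal (?g t) * indicator {..<real n} t" for n :: nat and t
  have F_le: "(\<integral>\<^sup>+t. F n t \<partial>lborel) \<le> 1" for n
  proof (cases "n = 0")
    case True
    then have "F n t = 0" for t
      by (auto simp: F_def indicator_def fgamma_density_nonpos)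
    then show ?thesis
      by simp
  next
    case False
    \<comment> \<open>Since \<open>power_kernel 1\<close> is the indicator of the positive
      half-line, this convolution is the integral truncated at n.\<close>
    have "has_bochner_integral lborel (\<lambda>t. ?g t * power_kernel 1 (real n - t)) (1 - prabhakar \<nu> 1 1 (real n))"
      using prabhakar_convolution[of \<nu> 1 1 0 "real n"] \<nu> False
      by (simp add: fgamma_density_def prabhakar_zero fgamma_density_one_cdf)
    moreover have "ennreal (?g t * power_kernel 1 (real n - t)) = F n t" for t
      by (auto simp: F_def power_kernel_def)
    ultimately have "(\<integral>\<^sup>+t. F n t \<partial>lborel) = ennreal (1 - prabhakar \<nu> 1 1 (real n))"
      using nn_integral_eq_integral[of lborel "\<lambda>t. ?g t * power_kernel 1 (real n - t)"]
      by (simp add: has_bochner_integral_iff fgamma_density_nonneg power_kernel_nonneg)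
    also have "\<dots> \<le> 1"
      using relaxation_pos[of "real n"] False by simp
    finally show ?thesis .
  qed
  have sup: "(SUP n. F n t) = ennreal (?g t)" for t
  proof (rule antisym)
    show "(SUP n. F n t) \<le> ennreal (?g t)"
      by (rule SUP_least) (simp add: F_def indicator_def)
    obtain n :: nat where "t < real n"
      using reals_Archimedean2 by blast
    then have "ennreal (?g t) = F n t"
      by (simp add: F_def)
    then show "ennreal (?g t) \<le> (SUP n. F n t)"
      by (auto intro: SUP_upper)
  qed
  have "incseq F"
    by (auto simp: incseq_def le_fun_def F_def indicator_def)
  then have "(\<integral>\<^sup>+t. (SUP n. F n t) \<partial>lborel) = (SUP n. \<integral>\<^sup>+t. F n t \<partial>lborel)"
    by (rule nn_integral_monotone_convergence_SUP) (unfold F_def, measurable)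
  also have "\<dots> \<le> 1"
    by (rule SUP_least) (rule F_le)
  finally show ?thesis
    unfolding sup .
qed

text \<open>Integer shapes have mass at most 1 by multiplicativity. A general \<delta> is completed
  to an integer by a second positive shape; the mass of the latter is nonzero by positivity, so an
  infinite mass for \<delta> would make the product infinite.\<close>

lemma nn_integral_fgamma_density_finite:
  assumes "0 < \<delta>"
  shows "(\<integral>\<^sup>+t. ennreal (fgamma_density \<nu> \<delta> t) \<partial>lborel) < \<infinity>"
proof -
  define I where "I \<delta> = (\<integral>\<^sup>+t. ennreal (fgamma_density \<nu> \<delta> t) \<partial>lborel)" for \<delta>
  have I_nat: "I (real (Suc n)) \<le> 1" for n
  proof (induction n)
    case (Suc n)
    have "I (real (Suc (Suc n))) = I (real (Suc n)) * I 1"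
      using nn_integral_fgamma_density_add[of "real (Suc n)" 1] by (simp add: I_def add_ac)
    also have "\<dots> \<le> 1 * 1"
      using Suc nn_integral_fgamma_density_one by (intro mult_mono) (simp_all add: I_def)
    finally show ?case
      by simp
  qed (simp add: I_def nn_integral_fgamma_density_one)
  have I_nz: "I \<epsilon> \<noteq> 0" if "0 < \<epsilon>" for \<epsilon>
  proof
    assume "I \<epsilon> = 0"
    then have "AE t in lborel. ennreal (fgamma_density \<nu> \<epsilon> t) = 0"
      unfolding I_def by (subst (asm) nn_integral_0_iff_AE) auto
    then have "AE t in lborel. t \<notin> {0<..<1::real}"
    proof eventually_elim
      case (elim t)
      then show ?case
        using fgamma_density_pos[OF that, of t] by (auto simp: ennreal_eq_0_iff)
    qed
    then show False
      using not_AE_avoids_interval[of 0 1] by simp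
  qed
  obtain n where n: "\<delta> < real n"
    using reals_Archimedean2 by blast
  have "I \<delta> * I (real (Suc n) - \<delta>) = I (real (Suc n))"
    using nn_integral_fgamma_density_add[of \<delta> "real (Suc n) - \<delta>"] assms n by (simp add: I_def)
  then have "I \<delta> * I (real (Suc n) - \<delta>) \<noteq> \<infinity>"
    using I_nat[of n] by (auto simp: top_unique)
  then have "I \<delta> \<noteq> \<infinity>"
    using I_nz[of "real (Suc n) - \<delta>"] n by (auto simp: ennreal_top_mult)
  then show ?thesis
    by (simp add: I_def less_top)
qed

section \<open>Integration over the simplex\<close>

lemma dirichlet_integrand_nonneg:
  "(\<And>j. j \<in> J \<Longrightarrow> 0 < \<beta> j) \<Longrightarrow> 0 < c \<Longrightarrow> 0 \<le> dirichlet_integrand \<nu> J \<beta> c s q y"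
  by (simp add: dirichlet_integrand_def fgamma_density_nonneg prod_nonneg)

text \<open>For fixed y, integrating out one coordinate is one convolution, which adds its shape to
  c. The total s is kept arbitrary because the induction hypothesis is applied at s - x.\<close>

lemma nn_integral_dirichlet_integrand:
  assumes "finite J" "\<And>j. j \<in> J \<Longrightarrow> 0 < \<beta> j" "0 < c" "0 < y"
  shows "(\<integral>\<^sup>+q. ennreal (dirichlet_integrand \<nu> J \<beta> c s q y) \<partial>Pi\<^sub>M J (\<lambda>_. lborel))
    = ennreal (fgamma_density \<nu> (c + (\<Sum>j\<in>J. \<beta> j)) (y * s))"
  using assms(1,2)
proof (induction J arbitrary: s rule: finite_induct)
  case empty
  interpret product_sigma_finite "\<lambda>_. lborel :: real measure" by standard
  show ?case
    using \<open>0 < y\<close> by (simp add: dirichlet_integrand_def space_PiM)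
next
  case (insert i J)
  interpret product_sigma_finite "\<lambda>_. lborel :: real measure" by standard
  let ?c = "c + (\<Sum>j\<in>J. \<beta> j)"
  have \<beta>: "0 < \<beta> i" "\<And>j. j \<in> J \<Longrightarrow> 0 < \<beta> j"
    using insert.prems by auto
  have c: "0 < ?c"
    using \<beta> \<open>0 < c\<close> by (intro add_pos_nonneg sum_nonneg) (auto intro: less_imp_le)
  have "(\<integral>\<^sup>+q. ennreal (dirichlet_integrand \<nu> (insert i J) \<beta> c s q y) \<partial>Pi\<^sub>M (insert i J) (\<lambda>_. lborel))
      = (\<integral>\<^sup>+x. \<integral>\<^sup>+q. ennreal (dirichlet_integrand \<nu> (insert i J) \<beta> c s (q(i := x)) y) \<partial>Pi\<^sub>M J (\<lambda>_. lborel) \<partial>lborel)"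
    using insert.hyps by (intro product_nn_integral_insert_rev) measurable
  also have "\<dots> = (\<integral>\<^sup>+x. ennreal (y * fgamma_density \<nu> (\<beta> i) (y * x)) * ennreal (fgamma_density \<nu> ?c (y * (s - x))) \<partial>lborel)"
  proof (rule nn_integral_cong)
    fix x
    have "(\<integral>\<^sup>+q. ennreal (dirichlet_integrand \<nu> (insert i J) \<beta> c s (q(i := x)) y) \<partial>Pi\<^sub>M J (\<lambda>_. lborel))
      = (\<integral>\<^sup>+q. ennreal (y * fgamma_density \<nu> (\<beta> i) (y * x)) * ennreal (dirichlet_integrand \<nu> J \<beta> c (s - x) q y) \<partial>Pi\<^sub>M J (\<lambda>_. lborel))"
      using insert.hyps \<beta> \<open>0 < c\<close> \<open>0 < y\<close>
      by (simp add: dirichlet_integrand_insert ennreal_mult dirichlet_integrand_nonneg fgamma_density_nonneg)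
    also have "\<dots> = ennreal (y * fgamma_density \<nu> (\<beta> i) (y * x)) * ennreal (fgamma_density \<nu> ?c (y * (s - x)))"
      using insert.IH[OF \<beta>(2)] by (subst nn_integral_cmult) simp_all
    finally show "(\<integral>\<^sup>+q. ennreal (dirichlet_integrand \<nu> (insert i J) \<beta> c s (q(i := x)) y) \<partial>Pi\<^sub>M J (\<lambda>_. lborel))
      = ennreal (y * fgamma_density \<nu> (\<beta> i) (y * x)) * ennreal (fgamma_density \<nu> ?c (y * (s - x)))" .
  qed
  \<comment> \<open>The factor y is the Jacobian of the substitution t = y x.\<close>
  also have "\<dots> = ennreal \<bar>y\<bar> * (\<integral>\<^sup>+x. ennreal (fgamma_density \<nu> (\<beta> i) (0 + y * x)) * ennreal (fgamma_density \<nu> ?c (y * s - (0 + y * x))) \<partial>lborel)"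
    using \<beta>(1) \<open>0 < y\<close>
    by (subst nn_integral_cmult[symmetric]) (simp_all add: ennreal_mult fgamma_density_nonneg mult.assoc right_diff_distrib)
  also have "\<dots> = (\<integral>\<^sup>+t. ennreal (fgamma_density \<nu> (\<beta> i) t) * ennreal (fgamma_density \<nu> ?c (y * s - t)) \<partial>lborel)"
    using \<open>0 < y\<close> by (intro nn_integral_real_affine[symmetric]) auto
  also have "\<dots> = ennreal (fgamma_density \<nu> (\<beta> i + ?c) (y * s))"
    using \<beta>(1) c by (rule fgamma_density_convolution)
  also have "\<beta> i + ?c = c + (\<Sum>j\<in>insert i J. \<beta> j)"
    using insert.hyps by simp
  finally show ?case .
qed

text \<open>The weight \<open>w\<close> holds the factors of coordinates that are not integrated
  out; it is 1 when all are. Writing the result with an empty index set keeps the cutoff at y =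
  0.\<close>

lemma nn_integral_dirichlet_integrand_weighted:
  fixes w :: "real \<Rightarrow> ennreal"
  assumes "finite J" "\<And>j. j \<in> J \<Longrightarrow> 0 < \<beta> j" "0 < c" and [measurable]: "w \<in> borel_measurable borel"
  shows "(\<integral>\<^sup>+q. \<integral>\<^sup>+y. w y * ennreal (dirichlet_integrand \<nu> J \<beta> c s q y) \<partial>lborel \<partial>Pi\<^sub>M J (\<lambda>_. lborel))
    = (\<integral>\<^sup>+y. w y * ennreal (dirichlet_integrand \<nu> {} \<beta> (c + (\<Sum>j\<in>J. \<beta> j)) s (\<lambda>_. 0) y) \<partial>lborel)"
proof -
  interpret product_sigma_finite "\<lambda>_. lborel :: real measure" by standard
  interpret P: sigma_finite_measure "Pi\<^sub>M J (\<lambda>_. lborel :: real measure)"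
    using assms(1) by (rule sigma_finite)
  interpret pair_sigma_finite "Pi\<^sub>M J (\<lambda>_. lborel :: real measure)" lborel ..
  have "(\<integral>\<^sup>+q. \<integral>\<^sup>+y. w y * ennreal (dirichlet_integrand \<nu> J \<beta> c s q y) \<partial>lborel \<partial>Pi\<^sub>M J (\<lambda>_. lborel))
    = (\<integral>\<^sup>+y. \<integral>\<^sup>+q. w y * ennreal (dirichlet_integrand \<nu> J \<beta> c s q y) \<partial>Pi\<^sub>M J (\<lambda>_. lborel) \<partial>lborel)"
    by (rule Fubini'[symmetric]) measurable
  also have "\<dots> = (\<integral>\<^sup>+y. w y * ennreal (dirichlet_integrand \<nu> {} \<beta> (c + (\<Sum>j\<in>J. \<beta> j)) s (\<lambda>_. 0) y) \<partial>lborel)"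
  proof (rule nn_integral_cong)
    fix y :: real
    have "(\<integral>\<^sup>+q. ennreal (dirichlet_integrand \<nu> J \<beta> c s q y) \<partial>Pi\<^sub>M J (\<lambda>_. lborel))
        = ennreal (dirichlet_integrand \<nu> {} \<beta> (c + (\<Sum>j\<in>J. \<beta> j)) s (\<lambda>_. 0) y)"
    proof (cases "0 < y")
      case True
      then show ?thesis
        using nn_integral_dirichlet_integrand[OF assms(1-3) True] by (simp add: dirichlet_integrand_def)
    qed (simp add: dirichlet_integrand_def)
    then show "(\<integral>\<^sup>+q. w y * ennreal (dirichlet_integrand \<nu> J \<beta> c s q y) \<partial>Pi\<^sub>M J (\<lambda>_. lborel))
        = w y * ennreal (dirichlet_integrand \<nu> {} \<beta> (c + (\<Sum>j\<in>J. \<beta> j)) s (\<lambda>_. 0) y)"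
      by (subst nn_integral_cmult) simp_all
  qed
  finally show ?thesis .
qed

text \<open>
  No integrability is needed: where the integral diverges, both sides take the value 0.
\<close>

lemma frac_dirichlet_density_eq_nn_integral:
  assumes "1 \<le> n" and \<beta>: "\<And>j. j \<in> {1..n} \<Longrightarrow> 0 < \<beta> j"
  shows "frac_dirichlet_density n \<nu> \<beta> q
    = enn2real (\<integral>\<^sup>+y. ennreal (dirichlet_integrand \<nu> {1..<n} \<beta> (\<beta> n) 1 q y) \<partial>lborel)"
proof (cases "(\<forall>j\<in>{1..<n}. 0 < q j) \<and> (\<Sum>j\<in>{1..<n}. q j) < 1")
  case False
  \<comment> \<open>Off the open simplex some density factor has a nonpositive argument and
    vanishes.\<close>
  have "dirichlet_integrand \<nu> {1..<n} \<beta> (\<beta> n) 1 q y = 0" if "0 < y" for y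
    using False
  proof (elim de_Morgan_conj[THEN iffD1, THEN disjE])
    assume "\<not> (\<forall>j\<in>{1..<n}. 0 < q j)"
    then obtain j where "j \<in> {1..<n}" "q j \<le> 0"
      by (auto simp: not_less)
    then have "\<exists>j\<in>{1..<n}. fgamma_density \<nu> (\<beta> j) (y * q j) = 0"
      using that by (intro bexI[of _ j] fgamma_density_nonpos) (auto simp: mult_nonneg_nonpos)
    then show ?thesis
      by (simp add: dirichlet_integrand_def prod_zero)
  next
    assume "\<not> (\<Sum>j\<in>{1..<n}. q j) < 1"
    then show ?thesis
      using that by (simp add: dirichlet_integrand_def fgamma_density_nonpos mult_nonneg_nonpos)
  qed
  then have "dirichlet_integrand \<nu> {1..<n} \<beta> (\<beta> n) 1 q y = 0" for y
    by (cases "0 < y") (auto simp: dirichlet_integrand_def)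
  then show ?thesis
    using False by (auto simp: frac_dirichlet_density_def)
next
  case True
  let ?J = "{1..<n}"
  define S where "S = (\<Sum>j\<in>?J. q j)"
  define C where "C = (\<Prod>j\<in>?J. q j powr (\<nu> * \<beta> j - 1)) * (1 - S) powr (\<nu> * \<beta> n - 1)"
  define E where "E y = (\<Prod>j\<in>?J. mittag_leffler3 \<nu> (\<nu> * \<beta> j) (\<beta> j) (- ((y * q j) powr \<nu>)))" for y
  define E' where "E' y = mittag_leffler3 \<nu> (\<nu> * \<beta> n) (\<beta> n) (- ((y - y * S) powr \<nu>))" for y
  let ?b = "\<Sum>j\<in>{1..n}. \<beta> j"
  have q: "\<And>j. j \<in> ?J \<Longrightarrow> 0 < q j" "S < 1"
    using True by (auto simp: S_def)
  have \<beta>': "\<And>j. j \<in> ?J \<Longrightarrow> 0 < \<beta> j" "0 < \<beta> n"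
    using \<beta> \<open>1 \<le> n\<close> by auto
  have eq: "C * (indicator {0<..} y *\<^sub>R (y powr (\<nu> * ?b - 1) * E y * E' y))
      = dirichlet_integrand \<nu> ?J \<beta> (\<beta> n) 1 q y" for y
  proof (cases "0 < y")
    case y: True
    have g: "fgamma_density \<nu> d (y * x) = y powr (\<nu> * d - 1) * (x powr (\<nu> * d - 1) * mittag_leffler3 \<nu> (\<nu> * d) d (- ((y * x) powr \<nu>)))"
      if "0 < d" "0 < x" for d x
      using prabhakar_eq_mittag_leffler3[of "\<nu> * d" d "y * x"] that y \<nu>
      by (simp add: fgamma_density_def powr_mult)
    have "(\<Prod>j\<in>?J. fgamma_density \<nu> (\<beta> j) (y * q j)) = (\<Prod>j\<in>?J. y powr (\<nu> * \<beta> j - 1)) * ((\<Prod>j\<in>?J. q j powr (\<nu> * \<beta> j - 1)) * E y)"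
      unfolding E_def prod.distrib[symmetric] using \<beta>' q by (intro prod.cong) (simp_all add: g)
    moreover have "fgamma_density \<nu> (\<beta> n) (y * (1 - S)) = y powr (\<nu> * \<beta> n - 1) * ((1 - S) powr (\<nu> * \<beta> n - 1) * E' y)"
      using g[of "\<beta> n" "1 - S"] \<beta>' q by (simp add: E'_def right_diff_distrib)
    \<comment> \<open>The n - 1 Jacobian factors cancel all but one of the n summands -1 in the
      exponents.\<close>
    moreover have "y ^ card ?J * (\<Prod>j\<in>?J. y powr (\<nu> * \<beta> j - 1)) * y powr (\<nu> * \<beta> n - 1) = y powr (\<nu> * ?b - 1)"
    proof -
      have "y ^ card ?J * (\<Prod>j\<in>?J. y powr (\<nu> * \<beta> j - 1)) * y powr (\<nu> * \<beta> n - 1)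
          = y powr (real (card ?J) + (\<Sum>j\<in>?J. \<nu> * \<beta> j - 1) + (\<nu> * \<beta> n - 1))"
        using y by (simp add: powr_add powr_sum powr_realpow)
      also have "(\<Sum>j\<in>?J. \<nu> * \<beta> j - 1) = \<nu> * (\<Sum>j\<in>?J. \<beta> j) - real (card ?J)"
        by (simp add: sum_subtractf sum_distrib_left)
      also have "(\<Sum>j\<in>?J. \<beta> j) = ?b - \<beta> n"
      proof -
        have "{1..n} = insert n ?J"
          using \<open>1 \<le> n\<close> by auto
        then show ?thesis
          by simp
      qed
      also have "real (card ?J) + (\<nu> * (?b - \<beta> n) - real (card ?J)) + (\<nu> * \<beta> n - 1) = \<nu> * ?b - 1"
        by (simp add: algebra_simps)
      finally show ?thesis .
    qed
    ultimately show ?thesis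
      using y unfolding dirichlet_integrand_def C_def S_def[symmetric]
      by (simp del: powr_mult card_atLeastLessThan)
  qed (simp add: dirichlet_integrand_def)
  have "frac_dirichlet_density n \<nu> \<beta> q = C * (LBINT y:{0<..}. y powr (\<nu> * ?b - 1) * E y * E' y)"
    using True by (simp add: frac_dirichlet_density_def C_def E_def E'_def S_def)
  also have "\<dots> = (\<integral>y. dirichlet_integrand \<nu> ?J \<beta> (\<beta> n) 1 q y \<partial>lborel)"
    unfolding set_lebesgue_integral_def eq[symmetric] by (rule integral_mult_right_zero[symmetric])
  also have "\<dots> = enn2real (\<integral>\<^sup>+y. ennreal (dirichlet_integrand \<nu> ?J \<beta> (\<beta> n) 1 q y) \<partial>lborel)"
    using \<beta>' by (intro integral_eq_nn_integral AE_I2 dirichlet_integrand_nonneg) auto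
  finally show ?thesis .
qed

end

section \<open>The marginal law of one coordinate\<close>

theorem corollary2p1:
  fixes n :: nat and \<nu> :: real and \<beta> :: "nat \<Rightarrow> real"
    and M :: "'a measure" and Q :: "nat \<Rightarrow> 'a \<Rightarrow> real" and \<beta>bar :: real
  defines "\<beta>bar \<equiv> (\<Sum>j\<in>{1..n}. \<beta> j)"
  assumes "n \<ge> 2"
    and "0 < \<nu>" and "\<nu> \<le> 1"
    and "\<And>j. j \<in> {1..n} \<Longrightarrow> 0 < \<beta> j"
    and "prob_space M"
    and "distributed M (PiM {1..<n} (\<lambda>_. lborel)) (\<lambda>\<omega>. \<lambda>i\<in>{1..<n}. Q i \<omega>)
           (\<lambda>q. ennreal (frac_dirichlet_density n \<nu> \<beta> q))"
    and "i \<in> {1..<n}"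
  shows "distributed M lborel (Q i)
           (\<lambda>x. ennreal (if 0 < x \<and> x < 1
              then x powr (\<nu> * \<beta> i - 1) * (1 - x) powr (\<nu> * (\<beta>bar - \<beta> i) - 1)
                * (LBINT y:{0<..}. y powr (\<nu> * \<beta>bar - 1)
                     * mittag_leffler3 \<nu> (\<nu> * \<beta> i) (\<beta> i) (- ((y * x) powr \<nu>))
                     * mittag_leffler3 \<nu> (\<nu> * (\<beta>bar - \<beta> i)) (\<beta>bar - \<beta> i)
                         (- ((y * (1 - x)) powr \<nu>)))
              else 0))"
proof -
  note \<nu> = assms(3,4) and \<beta> = assms(5) and D = assms(7) and i = assms(8)
  interpret product_sigma_finite "\<lambda>_. lborel :: real measure" by standard
  let ?J = "{1..<n}" and ?K = "{1..<n} - {i}"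
  let ?N = "Pi\<^sub>M ?J (\<lambda>_. lborel :: real measure)"
  define F where "F q = (\<integral>\<^sup>+y. ennreal (dirichlet_integrand \<nu> ?J \<beta> (\<beta> n) 1 q y) \<partial>lborel)" for q
  \<comment> \<open>The marginal is the Dirichlet density for \<open>n = 2\<close> with parameters \<open>\<gamma>\<close>.\<close>
  define \<gamma> where "\<gamma> = (\<lambda>j::nat. if j = 1 then \<beta> i else \<beta>bar - \<beta> i)"
  define F1 where "F1 x = (\<integral>\<^sup>+y. ennreal (dirichlet_integrand \<nu> {1..<2} \<gamma> (\<gamma> 2) 1 (\<lambda>_. x) y) \<partial>lborel)" for x
  have \<beta>J: "\<And>j. j \<in> ?J \<Longrightarrow> 0 < \<beta> j" "0 < \<beta> n"
    using \<beta> assms(2) by auto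
  have J: "?J = insert i ?K"
    using i by auto
  have \<beta>bar_J: "\<beta>bar = \<beta> n + (\<Sum>j\<in>?J. \<beta> j)"
  proof -
    have "{1..n} = insert n ?J"
      using assms(2) by auto
    then show ?thesis
      by (simp add: \<beta>bar_def)
  qed
  have \<beta>bar_K: "\<beta>bar - \<beta> i = \<beta> n + (\<Sum>j\<in>?K. \<beta> j)"
    using i by (simp add: \<beta>bar_J sum_diff1)
  have "0 < \<beta>bar" "0 < \<beta>bar - \<beta> i"
    unfolding \<beta>bar_K unfolding \<beta>bar_J using \<beta>J
    by (intro add_pos_nonneg sum_nonneg; fastforce)+
  then have \<gamma>: "0 < \<gamma> j" for j
    using \<beta>J(1)[OF i] by (simp add: \<gamma>_def)
  have F_meas [measurable]: "F \<in> borel_measurable ?N"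
    unfolding F_def by measurable
  have F1_meas [measurable]: "F1 \<in> borel_measurable lborel"
    unfolding F1_def by measurable
  have joint: "frac_dirichlet_density n \<nu> \<beta> q = enn2real (F q)" for q
    unfolding F_def using assms(2) \<beta> by (intro frac_dirichlet_density_eq_nn_integral[OF \<nu>]) auto
  have marginal: "(if 0 < x \<and> x < 1
              then x powr (\<nu> * \<beta> i - 1) * (1 - x) powr (\<nu> * (\<beta>bar - \<beta> i) - 1)
                * (LBINT y:{0<..}. y powr (\<nu> * \<beta>bar - 1)
                     * mittag_leffler3 \<nu> (\<nu> * \<beta> i) (\<beta> i) (- ((y * x) powr \<nu>))
                     * mittag_leffler3 \<nu> (\<nu> * (\<beta>bar - \<beta> i)) (\<beta>bar - \<beta> i)
                         (- ((y * (1 - x)) powr \<nu>)))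
              else 0) = enn2real (F1 x)" for x
  proof -
    have "{1..<2} = {1::nat}" "{1..2} = {1, 2::nat}"
      by auto
    then have "frac_dirichlet_density 2 \<nu> \<gamma> (\<lambda>_. x) = (if 0 < x \<and> x < 1
              then x powr (\<nu> * \<beta> i - 1) * (1 - x) powr (\<nu> * (\<beta>bar - \<beta> i) - 1)
                * (LBINT y:{0<..}. y powr (\<nu> * \<beta>bar - 1)
                     * mittag_leffler3 \<nu> (\<nu> * \<beta> i) (\<beta> i) (- ((y * x) powr \<nu>))
                     * mittag_leffler3 \<nu> (\<nu> * (\<beta>bar - \<beta> i)) (\<beta>bar - \<beta> i)
                         (- ((y * (1 - x)) powr \<nu>)))
              else 0)"
      by (simp add: frac_dirichlet_density_def \<gamma>_def right_diff_distrib)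
    then show ?thesis
      unfolding F1_def using \<gamma> by (simp add: frac_dirichlet_density_eq_nn_integral[OF \<nu>])
  qed
  \<comment> \<open>Integrating out all coordinates leaves the fractional Gamma density of shape
    \<open>\<beta>bar\<close> in y, whose mass is finite.\<close>
  have F_finite: "(\<integral>\<^sup>+q. F q \<partial>?N) < \<infinity>"
  proof -
    have "(\<integral>\<^sup>+q. F q \<partial>?N) = (\<integral>\<^sup>+y. ennreal (dirichlet_integrand \<nu> {} \<beta> \<beta>bar 1 (\<lambda>_. 0) y) \<partial>lborel)"
      using nn_integral_dirichlet_integrand_weighted[OF \<nu>, of ?J \<beta> "\<beta> n" "\<lambda>_. 1" 1] \<beta>J
      by (simp add: F_def \<beta>bar_J)
    also have "\<dots> \<le> (\<integral>\<^sup>+y. ennreal (fgamma_density \<nu> \<beta>bar y) \<partial>lborel)"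
      by (intro nn_integral_mono) (simp add: dirichlet_integrand_def)
    also have "\<dots> < \<infinity>"
      using \<open>0 < \<beta>bar\<close> by (rule nn_integral_fgamma_density_finite[OF \<nu>])
    finally show ?thesis .
  qed
  \<comment> \<open>Coordinate i is pinned at x and its factor becomes the weight; the others
    integrate to a single density of shape \<open>\<beta>bar - \<beta> i\<close> at y (1 -
    x).\<close>
  have slice: "(\<integral>\<^sup>+q. F (q(i := x)) \<partial>Pi\<^sub>M ?K (\<lambda>_. lborel)) = F1 x" for x
  proof -
    let ?w = "\<lambda>y. ennreal (y * fgamma_density \<nu> (\<beta> i) (y * x))"
    have "F (q(i := x)) = (\<integral>\<^sup>+y. ?w y * ennreal (dirichlet_integrand \<nu> ?K \<beta> (\<beta> n) (1 - x) q y) \<partial>lborel)" for q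
      unfolding F_def
    proof (rule nn_integral_cong)
      fix y
      have "dirichlet_integrand \<nu> ?J \<beta> (\<beta> n) 1 (q(i := x)) y
          = (y * fgamma_density \<nu> (\<beta> i) (y * x)) * dirichlet_integrand \<nu> ?K \<beta> (\<beta> n) (1 - x) q y"
        by (subst (1) J) (rule dirichlet_integrand_insert, auto)
      moreover have "0 \<le> dirichlet_integrand \<nu> ?K \<beta> (\<beta> n) (1 - x) q y"
        using \<beta>J by (intro dirichlet_integrand_nonneg[OF \<nu>]) auto
      ultimately show "ennreal (dirichlet_integrand \<nu> ?J \<beta> (\<beta> n) 1 (q(i := x)) y)
          = ?w y * ennreal (dirichlet_integrand \<nu> ?K \<beta> (\<beta> n) (1 - x) q y)"
        by (simp add: ennreal_mult'')
    qed
    then have "(\<integral>\<^sup>+q. F (q(i := x)) \<partial>Pi\<^sub>M ?K (\<lambda>_. lborel))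
        = (\<integral>\<^sup>+y. ?w y * ennreal (dirichlet_integrand \<nu> {} \<beta> (\<beta>bar - \<beta> i) (1 - x) (\<lambda>_. 0) y) \<partial>lborel)"
      using nn_integral_dirichlet_integrand_weighted[OF \<nu>, of ?K \<beta> "\<beta> n" ?w "1 - x"] \<beta>J
      by (simp add: \<beta>bar_K)
    also have "\<dots> = F1 x"
      unfolding F1_def
    proof (rule nn_integral_cong)
      fix y
      have "{1..<2} = {1::nat}"
        by auto
      then have "dirichlet_integrand \<nu> {1..<2} \<gamma> (\<gamma> 2) 1 (\<lambda>_. x) y
        = (y * fgamma_density \<nu> (\<beta> i) (y * x)) * dirichlet_integrand \<nu> {} \<beta> (\<beta>bar - \<beta> i) (1 - x) (\<lambda>_. 0) y"
        by (simp add: dirichlet_integrand_def \<gamma>_def)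
      moreover have "0 \<le> dirichlet_integrand \<nu> {} \<beta> (\<beta>bar - \<beta> i) (1 - x) (\<lambda>_. 0) y"
        using \<open>0 < \<beta>bar - \<beta> i\<close> by (intro dirichlet_integrand_nonneg[OF \<nu>]) auto
      ultimately show "?w y * ennreal (dirichlet_integrand \<nu> {} \<beta> (\<beta>bar - \<beta> i) (1 - x) (\<lambda>_. 0) y)
          = ennreal (dirichlet_integrand \<nu> {1..<2} \<gamma> (\<gamma> 2) 1 (\<lambda>_. x) y)"
        by (simp add: ennreal_mult'')
    qed
    finally show ?thesis .
  qed
  have marginalize: "(\<integral>\<^sup>+q. F q * indicator A (q i) \<partial>?N) = (\<integral>\<^sup>+x. F1 x * indicator A x \<partial>lborel)"
    if [measurable]: "A \<in> sets borel" for A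
  proof -
    have [measurable]: "F \<in> borel_measurable (Pi\<^sub>M (insert i ?K) (\<lambda>_. lborel))"
      unfolding J[symmetric] by (rule F_meas)
    have meas: "(\<lambda>q. F q * indicator A (q i)) \<in> borel_measurable (Pi\<^sub>M (insert i ?K) (\<lambda>_. lborel))"
      by measurable
    have "(\<integral>\<^sup>+q. F q * indicator A (q i) \<partial>Pi\<^sub>M (insert i ?K) (\<lambda>_. lborel))
        = (\<integral>\<^sup>+x. \<integral>\<^sup>+q. F (q(i := x)) * indicator A ((q(i := x)) i) \<partial>Pi\<^sub>M ?K (\<lambda>_. lborel) \<partial>lborel)"
      by (rule product_nn_integral_insert_rev[OF _ _ meas]) auto
    also have "\<dots> = (\<integral>\<^sup>+x. F1 x * indicator A x \<partial>lborel)"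
    proof (rule nn_integral_cong)
      fix x :: real
      have "(\<lambda>q. F (q(i := x))) \<in> borel_measurable (Pi\<^sub>M ?K (\<lambda>_. lborel))"
        by measurable
      then show "(\<integral>\<^sup>+q. F (q(i := x)) * indicator A ((q(i := x)) i) \<partial>Pi\<^sub>M ?K (\<lambda>_. lborel)) = F1 x * indicator A x"
        using slice[of x] by (simp add: nn_integral_multc)
    qed
    finally show ?thesis
      unfolding J[symmetric] .
  qed
  have F1_finite: "(\<integral>\<^sup>+x. F1 x \<partial>lborel) < \<infinity>"
    using marginalize[of UNIV] F_finite by simp
  \<comment> \<open>\<open>enn2real\<close> sends infinity to 0, so \<open>F\<close> and the real
    density may differ where the integral diverges; the finite total mass makes that a null
    set.\<close>
  have F_AE: "AE q in ?N. ennreal (enn2real (F q)) = F q"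
    using nn_integral_PInf_AE[OF F_meas] F_finite by (auto simp: less_top elim!: eventually_mono)
  have F1_AE: "AE x in lborel. ennreal (enn2real (F1 x)) = F1 x"
    using nn_integral_PInf_AE[OF F1_meas] F1_finite by (auto simp: less_top elim!: eventually_mono)
  have Q_meas: "Q i \<in> borel_measurable M"
  proof -
    have "(\<lambda>\<omega>. (\<lambda>j\<in>?J. Q j \<omega>) i) \<in> borel_measurable M"
      using measurable_compose[OF distributed_measurable[OF D] measurable_component_singleton[OF i]] by simp
    then show ?thesis
      using i by simp
  qed
  have "distr M lborel (Q i) = density lborel (\<lambda>x. ennreal (enn2real (F1 x)))"
  proof (rule measure_eqI)
    fix A
    assume "A \<in> sets (distr M lborel (Q i))"
    then have A [measurable]: "A \<in> sets borel"
      by simp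
    let ?B = "(\<lambda>q. q i) -` A \<inter> space ?N"
    have B: "?B \<in> sets ?N"
      using A by (intro measurable_sets[OF measurable_component_singleton[OF i]]) simp
    have "emeasure (distr M lborel (Q i)) A = emeasure M (Q i -` A \<inter> space M)"
      using Q_meas by (intro emeasure_distr) auto
    also have "Q i -` A \<inter> space M = (\<lambda>\<omega>. \<lambda>j\<in>?J. Q j \<omega>) -` ?B \<inter> space M"
      using i by (auto simp: space_PiM)
    also have "emeasure M \<dots> = (\<integral>\<^sup>+q. ennreal (frac_dirichlet_density n \<nu> \<beta> q) * indicator ?B q \<partial>?N)"
      using D B by (rule distributed_emeasure)
    \<comment> \<open>\<open>?B\<close> includes the intersection with the space of
      \<open>?N\<close>, so the two indicators agree only there; \<open>AE_space\<close> covers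
      this.\<close>
    also have "\<dots> = (\<integral>\<^sup>+q. F q * indicator A (q i) \<partial>?N)"
      using F_AE AE_space
      by (intro nn_integral_cong_AE) (auto simp: joint indicator_def elim!: eventually_elim2)
    also have "\<dots> = (\<integral>\<^sup>+x. F1 x * indicator A x \<partial>lborel)"
      using A by (rule marginalize)
    also have "\<dots> = (\<integral>\<^sup>+x. ennreal (enn2real (F1 x)) * indicator A x \<partial>lborel)"
      using F1_AE by (intro nn_integral_cong_AE) (auto elim!: eventually_mono)
    also have "\<dots> = emeasure (density lborel (\<lambda>x. ennreal (enn2real (F1 x)))) A"
      by (subst emeasure_density) simp_all
    finally show "emeasure (distr M lborel (Q i)) A = emeasure (density lborel (\<lambda>x. ennreal (enn2real (F1 x)))) A" .
  qed simp
  then show ?thesis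
    unfolding marginal distributed_def using Q_meas by simp
qed

end
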